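(* Let $q>0$ and $0<s<1$. The inequality $$e^{(1-s)\psi_q(x+a(q,s))}<\frac{\Gamma_q(x+1)}{\Gamma_q(x+s)}$$ holds for all $x>0$ with the best possible value $a(q,s)=I_{\psi_q}(s,1)$; that is, $I_{\psi_q}(s,1)$ is the largest constant $a$ such that $e^{(1-s)\psi_q(x+a)}<\Gamma_q(x+1)/\Gamma_q(x+s)$ holds for all $x>0$.
   Context: For $x>0$ the $q$-gamma function is defined by $$\Gamma_q(x)=\frac{(q;q)_\infty}{(q^x;q)_\infty}(1-q)^{1-x}\ \text{ if } 0<q<1,\qquad \Gamma_q(x)=\frac{(q^{-1};q^{-1})_\infty}{(q^{-x};q^{-1})_\infty}(q-1)^{1-x}q^{\frac12x(x-1)}\ \text{ if } q>1,$$ where $(a;q)_\infty=\prod_{n=0}^\infty(1-aq^n)$. For $q=1$ one sets $\Gamma_1=\Gamma$, Euler's gamma function. For $q>0$, $\psi_q=\Gamma_q'/\Gamma_q$ denotes the logarithmic derivative of $\Gamma_q$ on $(0,+\infty)$ (so $\psi_1=\psi$ is the digamma function); it is strictly increasing on $(0,+\infty)$. For $q>0$ and $t>s>0$, the integral $\psi_q$ mean of $s$ and $t$ is $$I_{\psi_q}(s,t)=\psi_q^{-1}\left(\frac{1}{t-s}\int_s^t\psi_q(u)\,du\right),$$ where $\psi_q^{-1}$ is the inverse function of $\psi_q$ on $(0,+\infty)$. *)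

theory Defs
  imports "HOL-Analysis.Analysis"
begin

text \<open>The infinite q-shifted factorial \<open>(a;q)\<^sub>\<infinity>\<close>; the product converges for \<open>\<bar>q\<bar> < 1\<close>.\<close>

definition qpoch_inf :: "real \<Rightarrow> real \<Rightarrow> real" where
  "qpoch_inf a q = (\<Prod>n. 1 - a * q ^ n)"

text \<open>Intended for \<open>q > 0\<close> and \<open>x > 0\<close> only.\<close>

definition qGamma :: "real \<Rightarrow> real \<Rightarrow> real" where
  "qGamma q x =
    (if q = 1 then Gamma x
     else if q < 1 then
       qpoch_inf q q / qpoch_inf (q powr x) q * (1 - q) powr (1 - x)
     else
       qpoch_inf (inverse q) (inverse q) / qpoch_inf (q powr (- x)) (inverse q)
         * (q - 1) powr (1 - x) * q powr (x * (x - 1) / 2))"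

definition qDigamma :: "real \<Rightarrow> real \<Rightarrow> real" where
  "qDigamma q x = deriv (qGamma q) x / qGamma q x"

text \<open>The integral \<open>f\<close> mean of \<open>s\<close> and \<open>t\<close>, for \<open>0 < s < t\<close> and \<open>f\<close> continuous and strictly
  monotone on the positive reals; the inverse is that of the restriction of \<open>f\<close> to
  the positive reals.\<close>

definition integral_mean :: "(real \<Rightarrow> real) \<Rightarrow> real \<Rightarrow> real \<Rightarrow> real" where
  "integral_mean f s t = inv_into {0<..} f (1 / (t - s) * integral {s..t} f)"

end

theory Submission
  imports Defs
begin

text \<open>
  For every \<open>q > 0\<close> the derivative \<open>\<psi>\<^sub>q'\<close> is a series of exponentials of convex functions and hence
  strictly log-convex: for \<open>q = 1\<close> the terms are \<open>(y + n)\<^sup>-\<^sup>2\<close>, and for \<open>q \<noteq> 1\<close>, with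
  \<open>p = min q q\<^sup>-\<^sup>1\<close>, they are multiples of \<open>p\<^sup>n\<^sup>y\<close>. Therefore \<open>\<psi>\<^sub>q'(x + u) / \<psi>\<^sub>q'(u)\<close> increases in \<open>u\<close>.
  If \<open>c\<close> is the integral mean of \<open>s\<close> and \<open>t\<close> and \<open>k\<close> is this ratio at \<open>u = c\<close>, then
  \<open>\<psi>\<^sub>q(x + u) - \<psi>\<^sub>q(x + c) - k (\<psi>\<^sub>q(u) - \<psi>\<^sub>q(c))\<close> has a strict minimum, with value 0, at \<open>u = c\<close>;
  integrating it over \<open>[s, t]\<close> gives the inequality. Letting \<open>x\<close> tend to 0 shows that \<open>c\<close> is best possible.
\<close>

section \<open>Strict log-convexity of series of exponentials\<close>

text \<open>The tangent of \<open>exp\<close> at the weighted mean \<open>m\<close> lies strictly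
  below the graph off \<open>m\<close>. Both \<open>A\<close> and \<open>B\<close> differ from
  \<open>m\<close>, and the weighted mean of the two tangent values is \<open>exp m\<close>.\<close>

lemma exp_strict_convex:
  fixes A B \<theta> :: real
  assumes "0 < \<theta>" "\<theta> < 1" "A \<noteq> B"
  shows "exp ((1 - \<theta>) * A + \<theta> * B) < (1 - \<theta>) * exp A + \<theta> * exp B"
proof -
  define m where "m = (1 - \<theta>) * A + \<theta> * B"
  have tangent: "exp m * (1 + (y - m)) < exp y" if "y \<noteq> m" for y
    using exp_minus_greater[of "m - y"] that by (simp add: exp_diff field_simps)
  have "A - m = \<theta> * (A - B)" "B - m = (1 - \<theta>) * (B - A)"
    by (simp_all add: m_def algebra_simps)
  with assms have "A \<noteq> m" "B \<noteq> m" by auto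
  then have "(1 - \<theta>) * (exp m * (1 + (A - m))) + \<theta> * (exp m * (1 + (B - m)))
      < (1 - \<theta>) * exp A + \<theta> * exp B"
    using assms tangent by (intro add_strict_mono mult_strict_left_mono) auto
  moreover have "(1 - \<theta>) * (exp m * (1 + (A - m))) + \<theta> * (exp m * (1 + (B - m))) = exp m"
    by (simp add: m_def algebra_simps)
  ultimately show ?thesis by (simp add: m_def)
qed

text \<open>
  Hoelder's inequality for the series, with equality excluded: if \<open>h\<^sub>i\<close> and \<open>h\<^sub>j\<close> have different
  increments from \<open>a\<close> to \<open>b\<close>, the terms at \<open>a\<close> and at \<open>b\<close> cannot be proportional.
\<close>

lemma strict_log_convex_series:
  fixes w :: "nat \<Rightarrow> real" and h :: "nat \<Rightarrow> real \<Rightarrow> real"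
  assumes sums: "\<And>y. y > 0 \<Longrightarrow> (\<lambda>n. w n * exp (h n y)) sums \<phi> y"
    and pos: "\<And>y. y > 0 \<Longrightarrow> \<phi> y > 0"
    and w: "\<And>n. w n \<ge> 0" "w i > 0" "w j > 0"
    and conv: "\<And>n. convex_on {0<..} (h n)"
    and ab: "0 < a" "0 < b" and ne: "h i b - h i a \<noteq> h j b - h j a"
    and \<theta>: "0 < \<theta>" "\<theta> < 1"
  shows "ln (\<phi> ((1 - \<theta>) * a + \<theta> * b)) < (1 - \<theta>) * ln (\<phi> a) + \<theta> * ln (\<phi> b)"
proof -
  define y where "y = (1 - \<theta>) * a + \<theta> * b"
  define m where "m = (1 - \<theta>) * ln (\<phi> a) + \<theta> * ln (\<phi> b)"
  have y: "y > 0" using ab \<theta> by (simp add: y_def add_pos_pos)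
  \<comment> \<open>\<open>exp m\<close> is the geometric mean of \<open>\<phi> a\<close> and
    \<open>\<phi> b\<close> with weights \<open>1 - \<theta>\<close> and \<open>\<theta>\<close>.
    After normalising by it and by \<open>\<phi> a\<close>, \<open>\<phi> b\<close>, the
    \<open>d n\<close> are the termwise gaps; they sum to \<open>1 - \<phi> y / exp m\<close>, so
    one positive gap among nonnegative ones suffices.\<close>
  define d where "d n = (1 - \<theta>) * (w n * exp (h n a) / \<phi> a) + \<theta> * (w n * exp (h n b) / \<phi> b)
      - w n * exp (h n y) / exp m" for n
  have "d sums ((1 - \<theta>) * (\<phi> a / \<phi> a) + \<theta> * (\<phi> b / \<phi> b) - \<phi> y / exp m)"
    unfolding d_def by (intro sums_diff sums_add sums_mult sums_divide sums ab y)
  then have d: "d sums (1 - \<phi> y / exp m)"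
    using pos[OF ab(1)] pos[OF ab(2)] by simp
  have d_eq: "d n = w n * ((1 - \<theta>) * exp (h n a - ln (\<phi> a)) + \<theta> * exp (h n b - ln (\<phi> b))
      - exp (h n y - m))" for n
    using pos[OF ab(1)] pos[OF ab(2)] by (simp add: d_def exp_diff algebra_simps)
  have le: "exp (h n y - m) \<le> exp ((1 - \<theta>) * (h n a - ln (\<phi> a)) + \<theta> * (h n b - ln (\<phi> b)))" for n
    using convex_onD[OF conv[of n], of \<theta> a b] ab \<theta> by (simp add: y_def m_def algebra_simps)
  have lt: "exp (h n y - m) < (1 - \<theta>) * exp (h n a - ln (\<phi> a)) + \<theta> * exp (h n b - ln (\<phi> b))"
    if "h n a - ln (\<phi> a) \<noteq> h n b - ln (\<phi> b)" for n
    using le[of n] exp_strict_convex[OF \<theta> that] by linarith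
  have nonneg: "d n \<ge> 0" for n
  proof (cases "h n a - ln (\<phi> a) = h n b - ln (\<phi> b)")
    case True
    have average: "(1 - \<theta>) * A + \<theta> * A = A" for A by (simp add: algebra_simps)
    have "exp (h n y - m) \<le> exp (h n b - ln (\<phi> b))" using le[of n] unfolding True average .
    then show ?thesis unfolding d_eq True average using w(1)[of n] by simp
  next
    case False
    then show ?thesis unfolding d_eq using lt[of n] w(1)[of n] by simp
  qed
  \<comment> \<open>Otherwise \<open>h i\<close> and \<open>h j\<close> would both increase by
    \<open>ln (\<phi> b) - ln (\<phi> a)\<close> from \<open>a\<close> to \<open>b\<close>, against
    \<open>ne\<close>.\<close>
  have "\<exists>k. w k > 0 \<and> h k a - ln (\<phi> a) \<noteq> h k b - ln (\<phi> b)"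
  proof (rule ccontr)
    assume "\<not> ?thesis"
    then have "h i a - ln (\<phi> a) = h i b - ln (\<phi> b)" "h j a - ln (\<phi> a) = h j b - ln (\<phi> b)"
      using w by blast+
    then show False using ne by linarith
  qed
  then obtain k where "w k > 0" "h k a - ln (\<phi> a) \<noteq> h k b - ln (\<phi> b)" by blast
  then have "d k > 0" unfolding d_eq using lt[of k] by simp
  then have "0 < suminf d" using d nonneg by (intro suminf_pos2) (auto simp: sums_iff)
  then have "\<phi> y / exp m < 1" using d by (simp add: sums_iff)
  then have "\<phi> y < exp m" by simp
  then have "ln (\<phi> y) < ln (exp m)" using pos[OF y] by (subst ln_less_cancel_iff) auto
  then show ?thesis by (simp add: y_def m_def)
qed

text \<open>Both \<open>x + u\<close> and \<open>v\<close> lie strictly between \<open>u\<close> and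
  \<open>x + v\<close>, and they have the same sum. They are therefore convex combinations of these
  end points with exchanged weights, and adding the two convexity inequalities removes the
  weights.\<close>

lemma strict_log_convex_ratio:
  fixes \<phi> :: "real \<Rightarrow> real"
  assumes pos: "\<And>y. y > 0 \<Longrightarrow> \<phi> y > 0"
    and conv: "\<And>a b \<theta>. \<lbrakk>0 < a; a < b; 0 < \<theta>; \<theta> < 1\<rbrakk> \<Longrightarrow>
      ln (\<phi> ((1 - \<theta>) * a + \<theta> * b)) < (1 - \<theta>) * ln (\<phi> a) + \<theta> * ln (\<phi> b)"
    and "0 < x" "0 < u" "u < v"
  shows "\<phi> (x + u) / \<phi> u < \<phi> (x + v) / \<phi> v"
proof -
  \<comment> \<open>The weight that places \<open>x + u\<close> in the interval from
    \<open>u\<close> to \<open>x + v\<close>; \<open>1 - \<theta>\<close> places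
    \<open>v\<close>.\<close>
  define \<theta> where "\<theta> = x / (x + v - u)"
  have D: "x + v - u > 0" using assms by linarith
  have \<theta>: "0 < \<theta>" "\<theta> < 1" using assms D by (auto simp: \<theta>_def field_simps)
  have \<theta>_mult: "\<theta> * (x + v - u) = x" using D by (simp add: \<theta>_def)
  have "(1 - \<theta>) * u + \<theta> * (x + v) = x + u"
    "(1 - (1 - \<theta>)) * u + (1 - \<theta>) * (x + v) = v"
    using \<theta>_mult by (simp_all add: algebra_simps)
  then have "ln (\<phi> (x + u)) < (1 - \<theta>) * ln (\<phi> u) + \<theta> * ln (\<phi> (x + v))"
    "ln (\<phi> v) < (1 - (1 - \<theta>)) * ln (\<phi> u) + (1 - \<theta>) * ln (\<phi> (x + v))"
    using conv[of u "x + v" \<theta>] conv[of u "x + v" "1 - \<theta>"] assms \<theta> by simp_all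
  then have "ln (\<phi> (x + u)) + ln (\<phi> v) < ln (\<phi> u) + ln (\<phi> (x + v))"
    by (simp add: algebra_simps)
  then have "ln (\<phi> (x + u) * \<phi> v) < ln (\<phi> u * \<phi> (x + v))"
    using assms pos by (simp add: ln_mult_pos)
  then have "\<phi> (x + u) * \<phi> v < \<phi> u * \<phi> (x + v)"
    using assms pos by (subst (asm) ln_less_cancel_iff) auto
  then show ?thesis using assms pos[of u] pos[of v] by (simp add: field_simps)
qed

section \<open>The mean inequality and its sharpness for a general function\<close>

text \<open>\<open>L\<close> stands for the logarithm of the gamma function. The hypothesis
  \<open>mean\<close> expresses through the antiderivative \<open>L\<close> that \<open>c\<close> is
  the integral mean of \<open>\<psi>\<close>, so no integral occurs here.\<close>

lemma shifted_mean_less: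
  fixes L \<psi> \<phi> :: "real \<Rightarrow> real"
  assumes L: "\<And>y. y > 0 \<Longrightarrow> (L has_real_derivative \<psi> y) (at y)"
    and \<psi>: "\<And>y. y > 0 \<Longrightarrow> (\<psi> has_real_derivative \<phi> y) (at y)"
    and pos: "\<And>y. y > 0 \<Longrightarrow> \<phi> y > 0"
    and ratio: "\<And>u v. \<lbrakk>0 < u; u < v\<rbrakk> \<Longrightarrow> \<phi> (x + u) / \<phi> u < \<phi> (x + v) / \<phi> v"
    and x: "0 < x" and c: "0 < s" "s < c" "c < t" and mean: "L t - L s = (t - s) * \<psi> c"
  shows "(t - s) * \<psi> (x + c) < L (x + t) - L (x + s)"
proof -
  define k where "k = \<phi> (x + c) / \<phi> c"
  define F where "F u = \<psi> (x + u) - \<psi> (x + c) - k * (\<psi> u - \<psi> c)" for u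
  \<comment> \<open>An antiderivative of \<open>F\<close>: its strict growth from \<open>s\<close>
    to \<open>c\<close> and from \<open>c\<close> to \<open>t\<close> replaces the integration of
    \<open>F\<close>.\<close>
  define \<Phi> where "\<Phi> u = L (x + u) - u * \<psi> (x + c) - k * (L u - u * \<psi> c)" for u
  have shift: "((\<lambda>u. f (x + u)) has_real_derivative f' (x + u)) (at u)"
    if "\<And>y. y > 0 \<Longrightarrow> (f has_real_derivative f' y) (at y)" "u > 0" for f f' u
    using that(1)[of "x + u"] that(2) x DERIV_shift[of f "f' (x + u)" u x]
    by (simp add: add.commute)
  have \<Phi>': "(\<Phi> has_real_derivative F u) (at u)" if "u > 0" for u
  proof -
    have "(\<Phi> has_real_derivative \<psi> (x + u) - 1 * \<psi> (x + c) - k * (\<psi> u - 1 * \<psi> c)) (at u)"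
      unfolding \<Phi>_def[abs_def]
      by (intro DERIV_diff DERIV_cmult DERIV_cmult_right DERIV_ident shift[OF L] L that)
    then show ?thesis by (simp add: F_def)
  qed
  have F': "(F has_real_derivative \<phi> (x + u) - k * \<phi> u) (at u)" if "u > 0" for u
  proof -
    have "(F has_real_derivative \<phi> (x + u) - 0 - k * (\<phi> u - 0)) (at u)"
      unfolding F_def[abs_def]
      by (intro DERIV_diff DERIV_cmult DERIV_const shift[OF \<psi>] \<psi> that)
    then show ?thesis by simp
  qed
  have cont: "continuous_on {a..b} f"
    if "\<And>y. y > 0 \<Longrightarrow> (f has_real_derivative f' y) (at y)" "a > 0" for f f' and a b :: real
    by (rule DERIV_continuous_on[where D = f'])
      (use that in \<open>force intro: has_field_derivative_at_within\<close>)
  have Fc: "F c = 0" by (simp add: F_def)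
  \<comment> \<open>The derivative of \<open>F\<close> at \<open>v\<close> is
    \<open>\<phi> v * (\<phi> (x + v) / \<phi> v - k)\<close>, which by \<open>ratio\<close> is
    negative before \<open>c\<close> and positive after it.\<close>
  have F_pos: "F u > 0" if u: "u > 0" "u \<noteq> c" for u
  proof (cases "u < c")
    case True
    have "F c < F u"
    proof (rule DERIV_neg_imp_decreasing_open[OF True])
      fix v assume v: "u < v" "v < c"
      have "\<phi> (x + v) - k * \<phi> v < 0"
        using ratio[of v c] v u pos[of v] by (simp add: k_def field_simps)
      then show "\<exists>y. (F has_real_derivative y) (at v) \<and> y < 0" using F'[of v] v u by auto
    qed (use cont[OF F'] u in auto)
    then show ?thesis using Fc by simp
  next
    case False
    then have cu: "c < u" using u by simp
    have "F c < F u"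
    proof (rule DERIV_pos_imp_increasing_open[OF cu])
      fix v assume v: "c < v" "v < u"
      have "\<phi> (x + v) - k * \<phi> v > 0"
        using ratio[of c v] v c pos[of v] by (simp add: k_def field_simps)
      then show "\<exists>y. (F has_real_derivative y) (at v) \<and> y > 0" using F'[of v] v c by auto
    qed (use cont[OF F'] c in auto)
    then show ?thesis using Fc by simp
  qed
  have "\<Phi> s < \<Phi> c"
    by (rule DERIV_pos_imp_increasing_open[OF c(2)])
      (use F_pos \<Phi>' c cont[OF \<Phi>'] in \<open>auto, smt (verit)\<close>)
  also have "\<Phi> c < \<Phi> t"
    by (rule DERIV_pos_imp_increasing_open[OF c(3)])
      (use F_pos \<Phi>' c cont[OF \<Phi>'] in \<open>auto, smt (verit)\<close>)
  finally have "(t - s) * \<psi> (x + c) + k * ((L t - L s) - (t - s) * \<psi> c) < L (x + t) - L (x + s)"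
    by (simp add: \<Phi>_def algebra_simps)
  then show ?thesis using mean by simp
qed

text \<open>Serves \<open>q = 1\<close> and \<open>q \<noteq> 1\<close> alike, with \<open>g\<close>
  the q-gamma function and \<open>\<psi>\<close> its logarithmic derivative. Each case then only has
  to supply the derivatives, the signs and the ratio condition.\<close>

lemma mean_inequality_sharp:
  fixes g \<psi> \<phi> :: "real \<Rightarrow> real"
  assumes g_pos: "\<And>y. y > 0 \<Longrightarrow> g y > 0"
    and g: "\<And>y. y > 0 \<Longrightarrow> (g has_real_derivative g y * \<psi> y) (at y)"
    and \<psi>: "\<And>y. y > 0 \<Longrightarrow> (\<psi> has_real_derivative \<phi> y) (at y)"
    and \<phi>_pos: "\<And>y. y > 0 \<Longrightarrow> \<phi> y > 0"
    and ratio: "\<And>x u v. \<lbrakk>0 < x; 0 < u; u < v\<rbrakk> \<Longrightarrow> \<phi> (x + u) / \<phi> u < \<phi> (x + v) / \<phi> v"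
    and s: "0 < s" "s < t"
  shows "(\<forall>x>0. exp ((t - s) * \<psi> (x + integral_mean \<psi> s t)) < g (x + t) / g (x + s))
    \<and> (\<forall>a. (\<forall>x>0. exp ((t - s) * \<psi> (x + a)) < g (x + t) / g (x + s))
          \<longrightarrow> a \<le> integral_mean \<psi> s t)"
proof -
  define L where "L y = ln (g y)" for y
  have L: "(L has_real_derivative \<psi> y) (at y)" if "y > 0" for y
    unfolding L_def[abs_def] using g_pos[OF that] g[OF that]
    by (auto intro!: derivative_eq_intros)
  have quot: "g y / g z = exp (L y - L z)" if "y > 0" "z > 0" for y z
    using g_pos that by (simp add: L_def exp_diff)
  have mono: "\<psi> u < \<psi> v" if "0 < u" "u < v" for u v
    by (rule DERIV_pos_imp_increasing[OF that(2)]) (use \<psi> \<phi>_pos that in \<open>meson order_less_le_trans\<close>)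
  then have inj: "inj_on \<psi> {0<..}" by (intro linorder_inj_onI) force+
  \<comment> \<open>The mean value theorem for \<open>L\<close> yields a preimage of the average of
    \<open>\<psi>\<close>; injectivity of \<open>\<psi>\<close> identifies it with the integral mean
    below.\<close>
  obtain c where c: "s < c" "c < t" "L t - L s = (t - s) * \<psi> c"
    using MVT2[OF s(2), of L \<psi>] L s by auto
  have "(\<psi> has_integral (L t - L s)) {s..t}"
    using s L by (intro fundamental_theorem_of_calculus)
      (auto simp flip: has_real_derivative_iff_has_vector_derivative
        intro: has_field_derivative_at_within)
  then have "integral_mean \<psi> s t = inv_into {0<..} \<psi> (\<psi> c)"
    using s c by (simp add: integral_mean_def integral_unique)
  then have mean: "integral_mean \<psi> s t = c" using inv_into_f_f[OF inj, of c] s c by simp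
  have "exp ((t - s) * \<psi> (x + c)) < g (x + t) / g (x + s)" if "x > 0" for x
    using shifted_mean_less[of L \<psi> \<phi> x s c t] L \<psi> \<phi>_pos ratio that s c by (simp add: quot)
  moreover have "a \<le> c" if a: "\<forall>x>0. exp ((t - s) * \<psi> (x + a)) < g (x + t) / g (x + s)" for a
  \<comment> \<open>Continuity of \<open>\<psi>\<close> at \<open>a\<close>, needed for the limit at
    0, is known only for \<open>a > 0\<close>. For \<open>a \<le> 0\<close> the claim is immediate
    from \<open>0 < s < c\<close>.\<close>
  proof (cases "a > 0")
    case True
    have ev: "eventually (\<lambda>x. (t - s) * \<psi> (x + a) \<le> L (x + t) - L (x + s)) (at_right 0)"
      using a s by (intro eventually_at_rightI[of 0 1]) (auto simp: quot less_imp_le)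
    have shift: "((\<lambda>x. f (x + b)) \<longlongrightarrow> f b) (at_right 0)"
      if "(f has_real_derivative D) (at b)" for f :: "real \<Rightarrow> real" and b D
    proof (rule isCont_tendsto_compose[OF DERIV_isCont[OF that]])
      show "((\<lambda>x. x + b) \<longlongrightarrow> b) (at_right 0)" by (auto intro!: tendsto_eq_intros)
    qed
    have "(t - s) * \<psi> a \<le> L t - L s"
      by (rule tendsto_le[OF _ _ _ ev]) (use s True in \<open>auto intro!: tendsto_intros shift[OF L] shift[OF \<psi>]\<close>)
    then have "\<psi> a \<le> \<psi> c" using c s by simp
    then show ?thesis using mono[of c a] s c by force
  qed (use s c in auto)
  ultimately show ?thesis by (auto simp: mean)
qed

section \<open>The case of Euler's gamma function\<close>

lemma Gamma_mean_inequality: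
  fixes s t :: real
  assumes "0 < s" "s < t"
  shows "(\<forall>x>0. exp ((t - s) * qDigamma 1 (x + integral_mean (qDigamma 1) s t))
            < qGamma 1 (x + t) / qGamma 1 (x + s))
    \<and> (\<forall>a. (\<forall>x>0. exp ((t - s) * qDigamma 1 (x + a)) < qGamma 1 (x + t) / qGamma 1 (x + s))
          \<longrightarrow> a \<le> integral_mean (qDigamma 1) s t)"
proof -
  have G: "qGamma 1 = Gamma" by (simp add: qGamma_def fun_eq_iff)
  have nonpos: "y \<notin> \<int>\<^sub>\<le>\<^sub>0" if "y > 0" for y :: real using that by (auto elim!: nonpos_Ints_cases)
  have D: "qDigamma 1 y = Digamma y" if "y > 0" for y
    using has_field_derivative_Gamma[OF nonpos[OF that], THEN DERIV_imp_deriv] Gamma_real_pos[OF that]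
    by (simp add: qDigamma_def G)
  have sums: "(\<lambda>n. 1 * exp (- 2 * ln (y + real n))) sums Polygamma 1 y" if "y > 0" for y :: real
  proof -
    have "exp (- 2 * ln (y + real n)) = inverse ((y + real n) ^ Suc 1)" for n
      using that exp_of_nat_mult[of 2 "ln (y + real n)"]
      by (simp add: exp_minus exp_ln add_pos_nonneg power2_eq_square)
    moreover have "summable (\<lambda>k. inverse ((y + of_nat k) ^ Suc 1))"
      by (rule Polygamma_converges') (use that in auto)
    ultimately show ?thesis by (simp add: Polygamma_def sums_iff)
  qed
  have pos: "Polygamma 1 y > 0" if "y > 0" for y :: real
    by (rule Polygamma_real_odd_pos) (use nonpos that in auto)
  have conv: "convex_on {0<..} (\<lambda>y. - 2 * ln (y + real n))" for n
  proof (rule f''_ge0_imp_convex)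
    show "((\<lambda>y. - 2 * ln (y + real n)) has_real_derivative - 2 / (y + real n)) (at y)"
      "((\<lambda>y. - 2 / (y + real n)) has_real_derivative 2 / (y + real n)\<^sup>2) (at y)"
      if "y \<in> {0<..}" for y
      using that by (auto intro!: derivative_eq_intros simp: power2_eq_square field_simps)
  qed auto
  show ?thesis
  proof (rule mean_inequality_sharp[where \<phi> = "Polygamma 1"])
    fix y :: real assume y: "y > 0"
    show "qGamma 1 y > 0" using y by (simp add: G)
    show "(qGamma 1 has_real_derivative qGamma 1 y * qDigamma 1 y) (at y)"
      using has_field_derivative_Gamma[OF nonpos[OF y]] D[OF y] by (simp add: G)
    show "(qDigamma 1 has_real_derivative Polygamma 1 y) (at y)"
      by (rule has_field_derivative_transform_within_open[of Digamma _ _ "{0<..}"])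
        (use has_field_derivative_Polygamma[OF nonpos[OF y], of 0] D y in auto)
    show "Polygamma 1 y > 0" using pos y .
  next
    fix x u v :: real assume "0 < x" "0 < u" "u < v"
    then show "Polygamma 1 (x + u) / Polygamma 1 u < Polygamma 1 (x + v) / Polygamma 1 v"
    proof (rule strict_log_convex_ratio[rotated 2])
      fix a b \<theta> :: real assume ab: "0 < a" "a < b" "0 < \<theta>" "\<theta> < 1"
      \<comment> \<open>The increments of the exponents with index 0 and 1 are \<open>-2\<close>
        times the logarithms of these two quotients.\<close>
      have "(b + 1) / (a + 1) \<noteq> b / a" using ab by (simp add: field_simps)
      then have "ln ((b + 1) / (a + 1)) \<noteq> ln (b / a)" using ab by (subst ln_inj_iff) auto
      then have "- 2 * ln (b + real 0) - - 2 * ln (a + real 0)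
          \<noteq> - 2 * ln (b + real 1) - - 2 * ln (a + real 1)"
        using ab by (simp add: ln_div)
      then show "ln (Polygamma 1 ((1 - \<theta>) * a + \<theta> * b))
          < (1 - \<theta>) * ln (Polygamma 1 a) + \<theta> * ln (Polygamma 1 b)"
        using ab by (intro strict_log_convex_series[where i = 0 and j = 1, OF sums pos _ _ _ conv]) auto
    qed (use pos in auto)
  qed (use assms in auto)
qed

section \<open>Differentiation of power series in \<open>p powr x\<close>\<close>

lemma powser_index_times:
  fixes c :: "nat \<Rightarrow> real"
  assumes "\<And>z. \<bar>z\<bar> < 1 \<Longrightarrow> summable (\<lambda>n. c n * z ^ n)" and "\<bar>z\<bar> < 1"
  shows "(\<lambda>n. real n * c n * z ^ n) sums (z * (\<Sum>n. diffs c n * z ^ n))"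
proof -
  have "summable (\<lambda>n. diffs c n * z ^ n)"
    by (rule termdiff_converges[where K = 1]) (use assms in auto)
  then have "(\<lambda>n. z * (real n * c n * z ^ (n - Suc 0))) sums (z * (\<Sum>n. diffs c n * z ^ n))"
    by (intro sums_mult diffs_equiv)
  moreover have "z * (real n * c n * z ^ (n - Suc 0)) = real n * c n * z ^ n" for n
    by (cases n) auto
  ultimately show ?thesis by simp
qed

text \<open>By the chain rule, differentiation in \<open>x\<close> is \<open>ln p\<close> times the
  operator \<open>z d/dz\<close> at \<open>z = p powr x\<close>, which multiplies the
  \<open>n\<close>-th coefficient by \<open>n\<close>. The result is again such a series, so the
  lemma can be applied twice to reach \<open>\<psi>\<close> and \<open>\<phi>\<close>.\<close>

lemma powser_powr_has_derivative:
  fixes c :: "nat \<Rightarrow> real"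
  assumes c: "\<And>z. \<bar>z\<bar> < 1 \<Longrightarrow> summable (\<lambda>n. c n * z ^ n)"
    and p: "0 < p" "p < 1" and x: "x > 0"
  shows "((\<lambda>x. \<Sum>n. c n * (p powr x) ^ n) has_real_derivative
      ln p * (\<Sum>n. real n * c n * (p powr x) ^ n)) (at x)"
proof -
  have z: "\<bar>p powr x\<bar> < 1" using p x by (simp add: powr01_less_one)
  have "((\<lambda>z. \<Sum>n. c n * z ^ n) has_real_derivative (\<Sum>n. diffs c n * (p powr x) ^ n)) (at (p powr x))"
    by (rule termdiffs_strong'[where K = 1]) (use c z in auto)
  moreover have "((\<lambda>x. p powr x) has_real_derivative p powr x * ln p) (at x)"
    using p by (auto intro!: derivative_eq_intros)
  ultimately have "((\<lambda>x. \<Sum>n. c n * (p powr x) ^ n) has_real_derivative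
      (\<Sum>n. diffs c n * (p powr x) ^ n) * (p powr x * ln p)) (at x)"
    by (rule DERIV_chain2)
  then show ?thesis using sums_unique[OF powser_index_times[OF c z]] by (simp add: mult_ac)
qed

section \<open>The q-shifted factorial and the q-gamma function as exponentials\<close>

definition qlog_coeff :: "real \<Rightarrow> nat \<Rightarrow> real" where
  "qlog_coeff p n = 1 / (real n * (1 - p ^ n))"

lemma qlog_coeff_pos:
  assumes "0 < p" "p < 1" "n > 0"
  shows "qlog_coeff p n > 0"
  using assms by (simp add: qlog_coeff_def power_less_one_iff)

text \<open>For \<open>n > 0\<close> the denominator \<open>n * (1 - p ^ n)\<close> is at least
  \<open>1 - p\<close>, which gives a geometric majorant.\<close>

lemma summable_qlog:
  assumes p: "0 < p" "p < 1" and z: "\<bar>z\<bar> < 1"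
  shows "summable (\<lambda>n. qlog_coeff p n * z ^ n)"
proof (rule summable_comparison_test')
  show "summable (\<lambda>n. 1 / (1 - p) * \<bar>z\<bar> ^ n)"
    using z by (intro summable_mult summable_geometric) auto
  show "norm (qlog_coeff p n * z ^ n) \<le> 1 / (1 - p) * \<bar>z\<bar> ^ n" for n
  proof (cases "n = 0")
    case False
    have "p ^ n \<le> p ^ 1" using p False by (intro power_decreasing) auto
    then have "1 * (1 - p) \<le> real n * (1 - p ^ n)" using p False by (intro mult_mono) auto
    then have "qlog_coeff p n \<le> 1 / (1 - p)"
      unfolding qlog_coeff_def using p by (intro frac_le) auto
    then have "qlog_coeff p n * \<bar>z\<bar> ^ n \<le> 1 / (1 - p) * \<bar>z\<bar> ^ n"
      by (intro mult_right_mono) auto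
    then show ?thesis
      using qlog_coeff_pos[of p n] p False by (simp add: abs_mult power_abs)
  qed (use p in \<open>simp add: qlog_coeff_def\<close>)
qed

text \<open>The series \<open>- ln (z;p)\<^sub>\<infinity> = (\<Sum>n\<ge>1. z\<^sup>n / (n (1 - p\<^sup>n)))\<close>; its coefficient at 0 is the junk value \<open>1/0 = 0\<close>.\<close>

definition qlog :: "real \<Rightarrow> real \<Rightarrow> real" where
  "qlog p z = (\<Sum>n. qlog_coeff p n * z ^ n)"

text \<open>Subtraction multiplies the \<open>n\<close>-th coefficient by \<open>1 - p ^ n\<close>,
  which leaves the logarithmic series with coefficients \<open>1 / n\<close>.\<close>

lemma qlog_functional_equation:
  assumes p: "0 < p" "p < 1" and z: "\<bar>z\<bar> < 1"
  shows "qlog p z - qlog p (p * z) = - ln (1 - z)"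
proof -
  have pz: "\<bar>p * z\<bar> < 1" using p z mult_strict_mono[of p 1 "\<bar>z\<bar>" 1] by (simp add: abs_mult)
  have "(\<lambda>n. qlog_coeff p n * z ^ n - qlog_coeff p n * (p * z) ^ n) sums (qlog p z - qlog p (p * z))"
    unfolding qlog_def by (intro sums_diff summable_sums summable_qlog p z pz)
  \<comment> \<open>The right-hand side has the shape of \<open>ln_series'\<close> at
    \<open>- z\<close>. For \<open>n = 0\<close> both sides vanish because division by 0 gives
    0.\<close>
  moreover have "qlog_coeff p n * z ^ n - qlog_coeff p n * (p * z) ^ n = - (- ((- (- z)) ^ n) / real n)" for n
  proof (cases "n = 0")
    case False
    then have "p ^ n \<noteq> 1" using p power_less_one_iff[of p n] by auto
    then have "qlog_coeff p n * (1 - p ^ n) = 1 / real n" by (simp add: qlog_coeff_def)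
    moreover have "qlog_coeff p n * z ^ n - qlog_coeff p n * (p * z) ^ n = qlog_coeff p n * (1 - p ^ n) * z ^ n"
      by (simp add: power_mult_distrib algebra_simps)
    ultimately show ?thesis by simp
  qed (simp add: qlog_coeff_def)
  moreover have "(\<lambda>n. - (- ((- (- z)) ^ n) / real n)) sums (- ln (1 + - z))"
    by (intro sums_minus ln_series') (use z in auto)
  ultimately show ?thesis by (simp add: sums_unique2)
qed

text \<open>The functional equation at the points \<open>z * p ^ i\<close> makes the partial
  products telescope; the remaining term tends to \<open>qlog p 0 = 0\<close>.\<close>

lemma qpoch_inf_eq_exp:
  assumes p: "0 < p" "p < 1" and z: "\<bar>z\<bar> < 1"
  shows "qpoch_inf z p = exp (- qlog p z)"
proof -
  have small: "\<bar>z * p ^ n\<bar> < 1" for n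
  proof -
    have "\<bar>z\<bar> * p ^ n \<le> \<bar>z\<bar> * 1" using p by (intro mult_left_mono power_le_one) auto
    then show ?thesis using z p by (simp add: abs_mult)
  qed
  have partial: "(\<Prod>i<n. 1 - z * p ^ i) = exp (qlog p (z * p ^ n) - qlog p z)" for n
  proof (induction n)
    case (Suc n)
    have eq: "p * (z * p ^ n) = z * p ^ Suc n" by simp
    have "exp (qlog p (z * p ^ Suc n) - qlog p (z * p ^ n)) = exp (ln (1 - z * p ^ n))"
      using qlog_functional_equation[OF p small[of n]] unfolding eq
      by (intro arg_cong[where f = exp]) linarith
    also have "\<dots> = 1 - z * p ^ n" using small[of n] by (intro exp_ln) linarith
    finally have step: "1 - z * p ^ n = exp (qlog p (z * p ^ Suc n) - qlog p (z * p ^ n))" ..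
    have "(\<Prod>i<Suc n. 1 - z * p ^ i)
        = exp (qlog p (z * p ^ n) - qlog p z) * exp (qlog p (z * p ^ Suc n) - qlog p (z * p ^ n))"
      by (simp only: prod.lessThan_Suc Suc.IH step)
    also have "\<dots> = exp (qlog p (z * p ^ Suc n) - qlog p z)"
      by (simp only: exp_add[symmetric]) simp
    finally show ?case .
  qed simp
  have "isCont (qlog p) 0"
    unfolding qlog_def[abs_def]
    by (rule isCont_powser[where K = "1 / 2"]) (use summable_qlog[OF p] in auto)
  moreover have "(\<lambda>n. z * p ^ n) \<longlonglongrightarrow> 0"
    using p by (intro tendsto_mult_right_zero LIMSEQ_power_zero) auto
  ultimately have "(\<lambda>n. qlog p (z * p ^ n)) \<longlonglongrightarrow> qlog p 0"
    by (rule isCont_tendsto_compose)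
  moreover have "qlog p 0 = 0" unfolding qlog_def powser_zero by (simp add: qlog_coeff_def)
  ultimately have "(\<lambda>n. exp (qlog p (z * p ^ n) - qlog p z)) \<longlonglongrightarrow> exp (0 - qlog p z)"
    by (intro tendsto_intros) simp
  then have lim: "(\<lambda>n. \<Prod>i<n. 1 - z * p ^ i) \<longlonglongrightarrow> exp (- qlog p z)" by (simp add: partial)
  have nz: "1 - z * p ^ i \<noteq> 0" for i using small[of i] by auto
  \<comment> \<open>\<open>convergent_prod\<close> demands a nonzero limit, which an exponential
    provides.\<close>
  have "convergent_prod (\<lambda>i. 1 - z * p ^ i)"
    using lim by (subst convergent_prod_iff_nz_lim[OF nz]) (auto simp: LIMSEQ_lessThan_iff_atMost)
  then show ?thesis
    unfolding qpoch_inf_def using lim by (simp add: prodinf_eq_lim'[OF _ nz] limI)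
qed

text \<open>Unites both branches of the definition: for \<open>q > 1\<close> the base becomes
  \<open>p = inverse q\<close>, and \<open>\<delta> = ln q\<close> carries the extra quadratic
  exponent; for \<open>q < 1\<close>, \<open>\<delta>\<close> is 0.\<close>

lemma qGamma_eq_exp:
  fixes q :: real
  defines "p \<equiv> min q (inverse q)" and "\<delta> \<equiv> max 0 (ln q)"
  assumes q: "q > 0" "q \<noteq> 1" and x: "x > 0"
  shows "qGamma q x = exp (qlog p (p powr x) - qlog p p + (1 - x) * ln \<bar>1 - q\<bar> + \<delta> * (x * (x - 1) / 2))"
proof (cases "q < 1")
  case True
  then have p: "p = q" using q one_less_inverse[of q] by (simp add: p_def)
  have "\<delta> = 0" using q True by (simp add: \<delta>_def)
  moreover have "(1 - q) powr (1 - x) = exp ((1 - x) * ln \<bar>1 - q\<bar>)"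
    using True by (simp add: powr_def)
  moreover have "qpoch_inf (q powr x) q = exp (- qlog q (q powr x))"
    using q x True by (intro qpoch_inf_eq_exp) (auto simp: powr01_less_one)
  moreover have "qpoch_inf q q = exp (- qlog q q)"
    using q True by (intro qpoch_inf_eq_exp) auto
  ultimately show ?thesis using q True by (simp add: p qGamma_def flip: exp_add exp_diff)
next
  case False
  then have q1: "q > 1" using q by simp
  then have p: "p = inverse q" using q1 inverse_less_1_iff[of q] by (simp add: p_def)
  have p01: "0 < inverse q" "inverse q < 1" using q1 by (auto simp: inverse_less_1_iff)
  have "\<delta> = ln q" using q1 by (simp add: \<delta>_def)
  moreover have "(q - 1) powr (1 - x) = exp ((1 - x) * ln \<bar>1 - q\<bar>)"
    using q1 by (simp add: powr_def)
  moreover have "q powr (x * (x - 1) / 2) = exp (ln q * (x * (x - 1) / 2))"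
    using q1 by (simp add: powr_def)
  moreover have "q powr (- x) = inverse q powr x"
    by (simp add: powr_minus inverse_powr)
  moreover have "qpoch_inf (inverse q powr x) (inverse q) = exp (- qlog (inverse q) (inverse q powr x))"
    using p01 x by (intro qpoch_inf_eq_exp) (auto simp: powr01_less_one)
  moreover have "qpoch_inf (inverse q) (inverse q) = exp (- qlog (inverse q) (inverse q))"
    using p01 by (intro qpoch_inf_eq_exp) auto
  ultimately have "qGamma q x = exp (- qlog (inverse q) (inverse q)) / exp (- qlog (inverse q) (inverse q powr x))
      * exp ((1 - x) * ln \<bar>1 - q\<bar>) * exp (\<delta> * (x * (x - 1) / 2))"
    using q1 by (simp add: qGamma_def)
  then show ?thesis by (simp add: p flip: exp_add exp_diff)
qed

section \<open>The case \<open>q \<noteq> 1\<close> and the conclusion\<close>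

lemma qGamma_mean_inequality:
  fixes q s t :: real
  assumes q: "q > 0" "q \<noteq> 1" and "0 < s" "s < t"
  shows "(\<forall>x>0. exp ((t - s) * qDigamma q (x + integral_mean (qDigamma q) s t))
            < qGamma q (x + t) / qGamma q (x + s))
    \<and> (\<forall>a. (\<forall>x>0. exp ((t - s) * qDigamma q (x + a)) < qGamma q (x + t) / qGamma q (x + s))
          \<longrightarrow> a \<le> integral_mean (qDigamma q) s t)"
proof -
  define p where "p = min q (inverse q)"
  define \<delta> where "\<delta> = max 0 (ln q)"
  have p: "0 < p" "p < 1"
    using q one_less_inverse_iff[of q] inverse_less_1_iff[of q] by (auto simp: p_def min_less_iff_disj)
  have lnp: "ln p < 0" using p by simp
  define c where "c = qlog_coeff p"
  define c' where "c' n = real n * c n" for n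
  define S S' where "S x = (\<Sum>n. c' n * (p powr x) ^ n)"
    and "S' x = (\<Sum>n. real n * c' n * (p powr x) ^ n)" for x
  \<comment> \<open>The derivative of the exponent in \<open>qGamma_eq_exp\<close>;
    \<open>\<phi>\<close> is the derivative of \<open>\<psi>\<close>.\<close>
  define \<psi> where "\<psi> x = ln p * S x - ln \<bar>1 - q\<bar> + \<delta> * (x - 1 / 2)" for x
  define \<phi> where "\<phi> x = (ln p)\<^sup>2 * S' x + \<delta>" for x
  have c: "summable (\<lambda>n. c n * z ^ n)" if "\<bar>z\<bar> < 1" for z
    unfolding c_def using summable_qlog[OF p that] .
  have c': "summable (\<lambda>n. c' n * z ^ n)" if "\<bar>z\<bar> < 1" for z
    unfolding c'_def using powser_index_times[OF c that] by (simp add: sums_iff)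
  have deriv_qlog: "((\<lambda>x. qlog p (p powr x)) has_real_derivative ln p * S y) (at y)" if "y > 0" for y
    using powser_powr_has_derivative[OF c p that] unfolding qlog_def S_def c'_def c_def .
  have deriv_S: "(S has_real_derivative ln p * S' y) (at y)" if "y > 0" for y
    using powser_powr_has_derivative[OF c' p that] unfolding S_def[abs_def] S'_def .
  note qGamma_eq = qGamma_eq_exp[OF q, folded p_def \<delta>_def]
  have pos: "qGamma q y > 0" if "y > 0" for y using that by (simp add: qGamma_eq)
  have deriv_qGamma: "(qGamma q has_real_derivative qGamma q y * \<psi> y) (at y)" if y: "y > 0" for y
  proof (rule has_field_derivative_transform_within_open[where S = "{0<..}"])
    define E where "E x = qlog p (p powr x) - qlog p p + (1 - x) * ln \<bar>1 - q\<bar> + \<delta> * (x * (x - 1) / 2)" for x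
    have "(E has_real_derivative \<psi> y) (at y)"
      unfolding E_def[abs_def]
      using y by (auto intro!: derivative_eq_intros deriv_qlog simp: \<psi>_def field_simps)
    then have "((\<lambda>x. exp (E x)) has_real_derivative exp (E y) * \<psi> y) (at y)"
      by (rule DERIV_fun_exp)
    then show "((\<lambda>x. exp (E x)) has_real_derivative qGamma q y * \<psi> y) (at y)"
      using y by (simp add: qGamma_eq E_def)
    show "exp (E x) = qGamma q x" if "x \<in> {0<..}" for x
      using that by (simp add: qGamma_eq E_def)
  qed (use y in auto)
  have D: "qDigamma q y = \<psi> y" if "y > 0" for y
    using deriv_qGamma[OF that, THEN DERIV_imp_deriv] pos[OF that] by (simp add: qDigamma_def)
  have deriv_\<psi>: "(\<psi> has_real_derivative \<phi> y) (at y)" if y: "y > 0" for y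
    unfolding \<psi>_def[abs_def]
    using y by (auto intro!: derivative_eq_intros deriv_S simp: \<phi>_def power2_eq_square)
  \<comment> \<open>The term of \<open>S'\<close> with index 0 vanishes, so this index is free to
    hold the constant \<open>\<delta>\<close>, with exponent \<open>h 0 y = 0\<close>.\<close>
  define w where "w n = (if n = 0 then \<delta> else (ln p)\<^sup>2 * (real n * c' n))" for n
  define h where "h n y = real n * (y * ln p)" for n :: nat and y
  have w_pos: "w n > 0" if "n > 0" for n
    using that lnp qlog_coeff_pos[OF p that] by (simp add: w_def c'_def c_def)
  have w_nonneg: "w n \<ge> 0" for n using w_pos[of n] by (cases "n = 0") (auto simp: w_def \<delta>_def)
  have sums: "(\<lambda>n. w n * exp (h n y)) sums \<phi> y" if y: "y > 0" for y
  proof -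
    have z: "\<bar>p powr y\<bar> < 1" using p y by (simp add: powr01_less_one)
    have "(\<lambda>n. real n * c' n * (p powr y) ^ n) sums S' y"
      using powser_index_times[OF c' z] by (simp add: S'_def sums_iff)
    then have "(\<lambda>n. (ln p)\<^sup>2 * (real n * c' n * (p powr y) ^ n) + (if n = 0 then \<delta> else 0)) sums \<phi> y"
      unfolding \<phi>_def by (intro sums_add sums_mult sums_single)
    moreover have "(ln p)\<^sup>2 * (real n * c' n * (p powr y) ^ n) + (if n = 0 then \<delta> else 0)
        = w n * exp (h n y)" for n
      using p by (simp add: w_def h_def powr_def flip: exp_of_nat_mult)
    ultimately show ?thesis by simp
  qed
  have \<phi>_pos: "\<phi> y > 0" if "y > 0" for y
    using suminf_pos2[of "\<lambda>n. w n * exp (h n y)" 1] sums[OF that] w_pos[of 1] w_nonneg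
    by (auto simp: sums_iff)
  have conv: "convex_on {0<..} (h n)" for n
    by (rule convex_onI) (auto simp: h_def algebra_simps)
  show ?thesis
  proof (rule mean_inequality_sharp[where \<phi> = \<phi>])
    fix y :: real assume y: "y > 0"
    show "qGamma q y > 0" using pos y .
    show "(qGamma q has_real_derivative qGamma q y * qDigamma q y) (at y)"
      using deriv_qGamma D y by simp
    show "(qDigamma q has_real_derivative \<phi> y) (at y)"
      by (rule has_field_derivative_transform_within_open[of \<psi> _ _ "{0<..}"])
        (use deriv_\<psi> D y in auto)
    show "\<phi> y > 0" using \<phi>_pos y .
  next
    fix x u v :: real assume "0 < x" "0 < u" "u < v"
    then show "\<phi> (x + u) / \<phi> u < \<phi> (x + v) / \<phi> v"
    proof (rule strict_log_convex_ratio[rotated 2])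
      fix a b \<theta> :: real assume ab: "0 < a" "a < b" "0 < \<theta>" "\<theta> < 1"
      \<comment> \<open>The \<open>h n\<close> are linear, hence convex but not strictly so;
        strictness comes from the different slopes \<open>ln p\<close> and
        \<open>2 * ln p\<close>.\<close>
      have "h 1 b - h 1 a \<noteq> h 2 b - h 2 a"
        using ab lnp by (simp add: h_def)
      then show "ln (\<phi> ((1 - \<theta>) * a + \<theta> * b)) < (1 - \<theta>) * ln (\<phi> a) + \<theta> * ln (\<phi> b)"
        using ab
        by (intro strict_log_convex_series[where i = 1 and j = 2, OF sums \<phi>_pos w_nonneg _ _ conv])
          (auto intro: w_pos)
    qed (use \<phi>_pos in auto)
  qed (use assms in auto)
qed

theorem corollary3p1:
  fixes q s :: real
  assumes "q > 0" and "0 < s" and "s < 1"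
  shows "(\<forall>x>0. exp ((1 - s) * qDigamma q (x + integral_mean (qDigamma q) s 1))
                  < qGamma q (x + 1) / qGamma q (x + s))
       \<and> (\<forall>a. (\<forall>x>0. exp ((1 - s) * qDigamma q (x + a))
                        < qGamma q (x + 1) / qGamma q (x + s))
              \<longrightarrow> a \<le> integral_mean (qDigamma q) s 1)"
proof (cases "q = 1")
  case True
  show ?thesis unfolding True by (rule Gamma_mean_inequality) fact+
next
  case False
  show ?thesis by (rule qGamma_mean_inequality) fact+
qed

end
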